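(* For $\mathbf{P}\in\mathcal{M}$ and $\boldsymbol{\xi}_{\mathbf{P}}=(\boldsymbol{\xi}_{\mathbf{P}_1},\dots,\boldsymbol{\xi}_{\mathbf{P}_U})\in T_{\mathbf{P}}\mathcal{M}$, let $$\gamma_k=\frac{\sqrt{P_k}}{\sqrt{\sum_{i\in\mathcal{U}_k}\mathrm{tr}\left((\mathbf{P}_i+\boldsymbol{\xi}_{\mathbf{P}_i})^H\mathbf{W}_i^H\mathbf{Q}_k\mathbf{W}_i(\mathbf{P}_i+\boldsymbol{\xi}_{\mathbf{P}_i})\right)}},\qquad k\in\{1,\dots,B\},$$ $$\boldsymbol{\Gamma}_i=\mathrm{blkdiag}\left(\gamma_{i_1}\mathbf{I}_{M_t},\gamma_{i_2}\mathbf{I}_{M_t},\cdots,\gamma_{i_{B_i}}\mathbf{I}_{M_t}\right),\qquad i\in\{1,\dots,U\}.$$ Then the mapping $$R^{\mathcal{M}}_{\mathbf{P}}:\ T_{\mathbf{P}}\mathcal{M}\to\mathcal{M},\qquad \boldsymbol{\xi}_{\mathbf{P}}\mapsto\left(\boldsymbol{\Gamma}_1(\mathbf{P}_1+\boldsymbol{\xi}_{\mathbf{P}_1}),\cdots,\boldsymbol{\Gamma}_U(\mathbf{P}_U+\boldsymbol{\xi}_{\mathbf{P}_U})\right)$$ is a retraction from $T_{\mathbf{P}}\mathcal{M}$ to $\mathcal{M}$.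
   Context: Let $B,U,M_t$ and $d_1,\dots,d_U$ be positive integers. For each $i\in\{1,\dots,U\}$, $\mathcal{B}_i=\{i_1,\dots,i_{B_i}\}\subseteq\{1,\dots,B\}$ is a nonempty set with $B_i$ (distinct) elements. For each $k\in\{1,\dots,B\}$, $\mathcal{U}_k=\{i\in\{1,\dots,U\}: k\in\mathcal{B}_i\}$. The numbers $P_k>0$, $k\in\{1,\dots,B\}$, are given. $\mathcal{N}=\mathcal{N}_1\times\cdots\times\mathcal{N}_U$ with $\mathcal{N}_i=\mathbb{C}^{B_iM_t\times d_i}$, regarded as a real linear manifold, so $T_{\mathbf{P}}\mathcal{N}=\mathcal{N}$. A point is $\mathbf{P}=(\mathbf{P}_1,\dots,\mathbf{P}_U)$ with $\mathbf{P}_i=[\mathbf{P}_{i,i_1}^T,\dots,\mathbf{P}_{i,i_{B_i}}^T]^T$, $\mathbf{P}_{i,k}\in\mathbb{C}^{M_t\times d_i}$. The Riemannian metric on $\mathcal{N}$ is $g^{\mathcal{N}}_{\mathbf{P}}(\boldsymbol{\xi}_{\mathbf{P}},\boldsymbol{\zeta}_{\mathbf{P}})=\sum_{i=1}^{U}\Re\{\mathrm{tr}(\boldsymbol{\zeta}_{\mathbf{P}_i}^H\boldsymbol{\xi}_{\mathbf{P}_i})\}$. $\mathbf{W}_i\in\mathbb{R}^{BM_t\times B_iM_t}$ is the block matrix made of $B\times B_i$ blocks of size $M_t\times M_t$ whose $(i_n,n)$ block is $\mathbf{I}_{M_t}$ for $n=1,\dots,B_i$ and whose other blocks are zero. $\mathbf{Q}_k\in\mathbb{C}^{BM_t\times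 BM_t}$ is the block diagonal matrix with $B$ diagonal blocks of size $M_t\times M_t$, whose $k$-th diagonal block is $\mathbf{I}_{M_t}$ and whose other blocks are zero. $\mathcal{M}$ is the Riemannian submanifold of $\mathcal{N}$ (with the induced metric) given by $$\mathcal{M}=\Big\{\mathbf{P}\in\mathcal{N}\ \Big|\ \sum_{i\in\mathcal{U}_k}\mathrm{tr}(\mathbf{P}_i^H\mathbf{W}_i^H\mathbf{Q}_k\mathbf{W}_i\mathbf{P}_i)=P_k,\ k=1,\dots,B\Big\},$$ whose tangent space at $\mathbf{P}\in\mathcal{M}$ is $$T_{\mathbf{P}}\mathcal{M}=\Big\{\boldsymbol{\xi}_{\mathbf{P}}\in T_{\mathbf{P}}\mathcal{N}\ \Big|\ \sum_{i\in\mathcal{U}_k}\mathrm{tr}\big(\boldsymbol{\xi}_{\mathbf{P}_i}^H\mathbf{W}_i^H\mathbf{Q}_k\mathbf{W}_i\mathbf{P}_i+\mathbf{P}_i^H\mathbf{W}_i^H\mathbf{Q}_k\mathbf{W}_i\boldsymbol{\xi}_{\mathbf{P}_i}\big)=0,\ k=1,\dots,B\Big\}.$$ A retraction on a manifold $\mathcal{M}$ (in the standard sense of Absil–Mahony–Sepulchre) is a smooth mapping $R$ from the tangent bundle $T\mathcal{M}$ to $\mathcal{M}$ whose restriction $R_{\mathbf{P}}$ to $T_{\mathbf{P}}\mathcal{M}$ satisfies, for every $\mathbf{P}\in\mathcal{M}$, $R_{\mathbf{P}}(\mathbf{0})=\mathbf{P}$ and $\mathrm{D}R_{\mathbf{P}}(\mathbf{0})=\mathrm{id}_{T_{\mathbf{P}}\mathcal{M}}$.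 *)

theory Defs
  imports
    "HOL-Analysis.Derivative"
    "HOL-Analysis.Finite_Function_Topology"
    "Jordan_Normal_Form.Schur_Decomposition"
begin

text \<open>
  \<^bold>\<open>Smoothness and retractions.\<close> Submanifolds are given as subsets of a real normed
  space, together with their tangent spaces as linear subspaces of that space.
\<close>

primrec Ck_on :: "nat \<Rightarrow> ('a::real_normed_vector \<Rightarrow> 'b::real_normed_vector) \<Rightarrow> 'a set \<Rightarrow> bool" where
  "Ck_on 0 f S \<longleftrightarrow> continuous_on S f"
| "Ck_on (Suc n) f S \<longleftrightarrow>
     (\<forall>x\<in>S. f differentiable (at x)) \<and>
     (\<forall>v. Ck_on n (\<lambda>x. frechet_derivative f (at x) v) S)"

text \<open>
  A map on an embedded submanifold \<open>S\<close> is smooth iff near every point of \<open>S\<close> it is the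
  restriction of a smooth map defined on an open subset of the ambient space. If \<open>S\<close> lies in a
  finite-dimensional subspace of the ambient space, as it does below, then it makes no difference
  whether the extension is to an open subset of that subspace or of the whole space: compose with a
  continuous linear projection in one direction and restrict in the other. For the same reason the
  directional formulation of \<open>Ck_on\<close> yields the usual notion of a smooth map.
\<close>

definition smooth_map_on :: "'a::real_normed_vector set \<Rightarrow> ('a \<Rightarrow> 'b::real_normed_vector) \<Rightarrow> bool" where
  "smooth_map_on S f \<longleftrightarrow>
     (\<forall>x\<in>S. \<exists>V g. open V \<and> x \<in> V \<and> (\<forall>n. Ck_on n g V) \<and> (\<forall>y\<in>V \<inter> S. g y = f y))"

text \<open>
  \<open>T x\<close> is the tangent space of \<open>M\<close> at \<open>x\<close>. The derivative of \<open>R x\<close> is that of a map on the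
  linear space \<open>T x\<close>, hence is taken within \<open>T x\<close>.
\<close>

definition is_retraction ::
  "'a::real_normed_vector set \<Rightarrow> ('a \<Rightarrow> 'a set) \<Rightarrow> ('a \<Rightarrow> 'a \<Rightarrow> 'a) \<Rightarrow> bool" where
  "is_retraction M T R \<longleftrightarrow>
     (\<forall>x\<in>M. \<forall>v\<in>T x. R x v \<in> M) \<and>
     smooth_map_on (SIGMA x:M. T x) (\<lambda>(x, v). R x v) \<and>
     (\<forall>x\<in>M. R x 0 = x \<and> (R x has_derivative (\<lambda>v. v)) (at 0 within T x))"

text \<open>
  \<^bold>\<open>Tuples of matrices of different sizes.\<close> \<open>bs i\<close> lists the elements of the set
  \<open>\<B>\<^sub>i\<close> in the order \<open>i\<^sub>1, i\<^sub>2, \<dots>\<close>, so that \<open>B\<^sub>i = length (bs i)\<close>. The indices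
  of the tuple (\<open>1..U\<close>) and of the stations (\<open>1..B\<close>) start at one, matrix entries and list
  positions at zero.

  A tuple \<open>(P\<^sub>1, \<dots>, P\<^sub>U)\<close> is the finitely supported function that maps \<open>(i, r, c)\<close> to the
  entry \<open>(r, c)\<close> of \<open>P\<^sub>i\<close>. This makes the product space a finite-dimensional subspace of a
  real normed space; addition and real scaling are componentwise.
\<close>

type_synonym tuple = "(nat \<times> nat \<times> nat) \<Rightarrow>\<^sub>0 complex"

definition prod_space :: "nat \<Rightarrow> nat \<Rightarrow> (nat \<Rightarrow> nat) \<Rightarrow> (nat \<Rightarrow> nat list) \<Rightarrow> tuple set" where
  "prod_space U Mt d bs =
     {P. Poly_Mapping.keys P \<subseteq>
           {(i, r, c). i \<in> {1..U} \<and> r < length (bs i) * Mt \<and> c < d i}}"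

definition component ::
  "nat \<Rightarrow> (nat \<Rightarrow> nat) \<Rightarrow> (nat \<Rightarrow> nat list) \<Rightarrow> tuple \<Rightarrow> nat \<Rightarrow> complex mat" where
  "component Mt d bs P i =
     mat (length (bs i) * Mt) (d i) (\<lambda>(r, c). Poly_Mapping.lookup P (i, r, c))"

definition tuple_of :: "nat \<Rightarrow> (nat \<Rightarrow> complex mat) \<Rightarrow> tuple" where
  "tuple_of U X =
     (\<Sum>i\<in>{1..U}. \<Sum>r<dim_row (X i). \<Sum>c<dim_col (X i).
        Poly_Mapping.single (i, r, c) (X i $$ (r, c)))"

lemma lookup_tuple_of:
  "Poly_Mapping.lookup (tuple_of U X) (i, r, c) =
     (if i \<in> {1..U} \<and> r < dim_row (X i) \<and> c < dim_col (X i) then X i $$ (r, c) else 0)"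
proof -
  have "Poly_Mapping.lookup (tuple_of U X) (i, r, c) =
    (\<Sum>i'\<in>{1..U}. \<Sum>r'<dim_row (X i'). \<Sum>c'<dim_col (X i').
       if c' = c then if r' = r then if i' = i then X i' $$ (r', c') else 0 else 0 else 0)"
    unfolding tuple_of_def lookup_sum lookup_single when_def
    by (intro sum.cong refl) auto
  also have "\<dots> = (\<Sum>i'\<in>{1..U}. \<Sum>r'<dim_row (X i').
       if r' = r then if c < dim_col (X i') \<and> i' = i then X i' $$ (r', c) else 0 else 0)"
    by (intro sum.cong refl) (simp add: sum.delta)
  also have "\<dots> = (\<Sum>i'\<in>{1..U}.
       if i' = i then if r < dim_row (X i') \<and> c < dim_col (X i') then X i' $$ (r, c) else 0 else 0)"
    by (intro sum.cong refl) (simp add: sum.delta)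
  finally show ?thesis
    by (simp add: sum.delta)
qed

lemma component_tuple_of:
  assumes "i \<in> {1..U}" "X i \<in> carrier_mat (length (bs i) * Mt) (d i)"
  shows "component Mt d bs (tuple_of U X) i = X i"
  using assms by (intro eq_matI) (auto simp: component_def lookup_tuple_of)

lemma tuple_of_component:
  assumes "P \<in> prod_space U Mt d bs"
  shows "tuple_of U (component Mt d bs P) = P"
proof (rule poly_mapping_eqI)
  fix k :: "nat \<times> nat \<times> nat"
  obtain i r c where k: "k = (i, r, c)" by (cases k)
  show "Poly_Mapping.lookup (tuple_of U (component Mt d bs P)) k = Poly_Mapping.lookup P k"
    using assms unfolding k lookup_tuple_of
    by (auto simp: component_def prod_space_def in_keys_iff)
qed

lemma tuple_of_in_prod_space:
  assumes "\<And>i. i \<in> {1..U} \<Longrightarrow> X i \<in> carrier_mat (length (bs i) * Mt) (d i)"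
  shows "tuple_of U X \<in> prod_space U Mt d bs"
  using assms by (force simp: prod_space_def in_keys_iff lookup_tuple_of split: if_splits)

text \<open>\<^bold>\<open>The manifold with fixed transmit powers.\<close>\<close>

definition tr :: "'a::comm_monoid_add mat \<Rightarrow> 'a" where
  "tr A = (\<Sum>i<dim_row A. A $$ (i, i))"

definition users :: "nat \<Rightarrow> (nat \<Rightarrow> nat list) \<Rightarrow> nat \<Rightarrow> nat set" where
  "users U bs k = {i \<in> {1..U}. k \<in> set (bs i)}"

text \<open>Entry \<open>(r, c)\<close> lies in the block \<open>(r div Mt + 1, c div Mt + 1)\<close>.\<close>

definition W_mat :: "nat \<Rightarrow> nat \<Rightarrow> (nat \<Rightarrow> nat list) \<Rightarrow> nat \<Rightarrow> complex mat" where
  "W_mat B Mt bs i = mat (B * Mt) (length (bs i) * Mt)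
     (\<lambda>(r, c). if r div Mt + 1 = bs i ! (c div Mt) \<and> r mod Mt = c mod Mt then 1 else 0)"

definition Q_mat :: "nat \<Rightarrow> nat \<Rightarrow> nat \<Rightarrow> complex mat" where
  "Q_mat B Mt k =
     diag_block_mat (map (\<lambda>l. if l = k then 1\<^sub>m Mt else 0\<^sub>m Mt Mt) [1..<Suc B])"

definition power_term ::
  "nat \<Rightarrow> nat \<Rightarrow> (nat \<Rightarrow> nat) \<Rightarrow> (nat \<Rightarrow> nat list) \<Rightarrow> nat \<Rightarrow> nat \<Rightarrow> tuple \<Rightarrow> tuple \<Rightarrow> complex mat" where
  "power_term B Mt d bs k i X Y =
     mat_adjoint (component Mt d bs X i) * mat_adjoint (W_mat B Mt bs i) * Q_mat B Mt k *
     W_mat B Mt bs i * component Mt d bs Y i"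

definition power_manifold ::
  "nat \<Rightarrow> nat \<Rightarrow> nat \<Rightarrow> (nat \<Rightarrow> nat) \<Rightarrow> (nat \<Rightarrow> nat list) \<Rightarrow> (nat \<Rightarrow> real) \<Rightarrow> tuple set" where
  "power_manifold B U Mt d bs p =
     {P \<in> prod_space U Mt d bs.
        \<forall>k\<in>{1..B}. (\<Sum>i\<in>users U bs k. tr (power_term B Mt d bs k i P P)) = complex_of_real (p k)}"

definition tangent_space ::
  "nat \<Rightarrow> nat \<Rightarrow> nat \<Rightarrow> (nat \<Rightarrow> nat) \<Rightarrow> (nat \<Rightarrow> nat list) \<Rightarrow> tuple \<Rightarrow> tuple set" where
  "tangent_space B U Mt d bs P =
     {\<xi> \<in> prod_space U Mt d bs.
        \<forall>k\<in>{1..B}. (\<Sum>i\<in>users U bs k.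
          tr (power_term B Mt d bs k i \<xi> P + power_term B Mt d bs k i P \<xi>)) = 0}"

text \<open>
  The traces under the root are nonnegative reals, whence \<open>Re\<close>. If their sum were zero,
  then \<open>gamma\<close> would be zero (division by zero) and the result of the map below would
  violate the \<open>k\<close>-th constraint; so a proof that the map takes values in the manifold includes
  a proof that \<open>gamma\<close> is well defined.
\<close>

definition gamma ::
  "nat \<Rightarrow> nat \<Rightarrow> nat \<Rightarrow> (nat \<Rightarrow> nat) \<Rightarrow> (nat \<Rightarrow> nat list) \<Rightarrow> (nat \<Rightarrow> real) \<Rightarrow> tuple \<Rightarrow> tuple \<Rightarrow> nat \<Rightarrow> real" where
  "gamma B U Mt d bs p P \<xi> k =
     sqrt (p k) / sqrt (Re (\<Sum>i\<in>users U bs k. tr (power_term B Mt d bs k i (P + \<xi>) (P + \<xi>))))"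

definition Gamma_mat ::
  "nat \<Rightarrow> nat \<Rightarrow> nat \<Rightarrow> (nat \<Rightarrow> nat) \<Rightarrow> (nat \<Rightarrow> nat list) \<Rightarrow> (nat \<Rightarrow> real) \<Rightarrow> tuple \<Rightarrow> tuple \<Rightarrow> nat \<Rightarrow> complex mat" where
  "Gamma_mat B U Mt d bs p P \<xi> i =
     diag_block_mat (map (\<lambda>k. complex_of_real (gamma B U Mt d bs p P \<xi> k) \<cdot>\<^sub>m 1\<^sub>m Mt) (bs i))"

definition power_retraction ::
  "nat \<Rightarrow> nat \<Rightarrow> nat \<Rightarrow> (nat \<Rightarrow> nat) \<Rightarrow> (nat \<Rightarrow> nat list) \<Rightarrow> (nat \<Rightarrow> real) \<Rightarrow> tuple \<Rightarrow> tuple \<Rightarrow> tuple" where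
  "power_retraction B U Mt d bs p P \<xi> =
     tuple_of U (\<lambda>i. Gamma_mat B U Mt d bs p P \<xi> i *
                     (component Mt d bs P i + component Mt d bs \<xi> i))"

end

theory Submission
  imports Defs
begin

text \<open>
  In coordinates \<open>W\<^sub>i\<^sup>H Q\<^sub>k W\<^sub>i\<close> is the diagonal projection onto the rows of \<open>P\<^sub>i\<close> that
  belong to station \<open>k\<close>. Hence the \<open>k\<close>-th constraint fixes the norm of the block of all entries
  served by station \<open>k\<close>, so the manifold is a product of spheres and the map normalises each block
  of \<open>P + \<xi>\<close>. A tangent vector is orthogonal to \<open>P\<close> in every block, so the squared norm of block
  \<open>k\<close> of \<open>P + \<xi>\<close> is \<open>P\<^sub>k\<close> plus that of \<open>\<xi>\<close>. It is therefore positive, which makes the map well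
  defined and smooth, and it differs from \<open>P\<^sub>k\<close> only to second order in \<open>\<xi>\<close>, which makes the
  derivative at zero the identity.
\<close>

subsection \<open>Calculus of smooth maps\<close>

lemma Ck_on_continuous_on: "Ck_on n f S \<Longrightarrow> continuous_on S f"
proof (cases n)
  case (Suc m)
  moreover assume "Ck_on n f S"
  ultimately show ?thesis
    by (auto intro!: continuous_at_imp_continuous_on differentiable_imp_continuous_within)
qed simp

text \<open>The recursion lowers the order only by passing to a derivative, so the inclusion needs
  its own induction; at the bottom it is continuity of a differentiable map. Product rules need it,
  since one factor stays undifferentiated.\<close>

lemma Ck_on_SucD: "Ck_on (Suc n) f S \<Longrightarrow> Ck_on n f S"
proof (induction n arbitrary: f)
  case 0
  then show ?case using Ck_on_continuous_on[OF 0] by simp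
next
  case (Suc n)
  then show ?case unfolding Ck_on.simps(2)[of "Suc n"] Ck_on.simps(2)[of n f] by blast
qed

text \<open>On an open set, pointwise equality forces equal derivatives, and the induction repeats
  this for each directional derivative.\<close>

lemma Ck_on_cong:
  assumes "open S" "\<And>x. x \<in> S \<Longrightarrow> f x = g x" "Ck_on n g S"
  shows "Ck_on n f S"
  using assms(2,3)
proof (induction n arbitrary: f g)
  case 0
  then show ?case by (auto cong: continuous_on_cong)
next
  case (Suc n)
  have der: "(f has_derivative frechet_derivative g (at x)) (at x)" if "x \<in> S" for x
  proof (rule has_derivative_transform_within_open[OF _ \<open>open S\<close> that])
    show "(g has_derivative frechet_derivative g (at x)) (at x)"
      using Suc.prems(2) that by (simp flip: frechet_derivative_works)
  qed (use Suc.prems(1) in metis)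
  have "Ck_on n (\<lambda>x. frechet_derivative f (at x) v) S" for v
  proof (rule Suc.IH)
    show "frechet_derivative f (at x) v = frechet_derivative g (at x) v" if "x \<in> S" for x
      using frechet_derivative_at[OF der[OF that]] by simp
    show "Ck_on n (\<lambda>x. frechet_derivative g (at x) v) S"
      using Suc.prems(2) by simp
  qed
  with der show ?case unfolding differentiable_def Ck_on.simps by blast
qed

text \<open>Uniqueness of the derivative replaces the chosen \<open>frechet_derivative\<close> by
  any explicit formula. The closure rules below that differentiate pass through this rule.\<close>

lemma Ck_on_SucI:
  assumes "open S" "\<And>x. x \<in> S \<Longrightarrow> (f has_derivative f' x) (at x)" "\<And>v. Ck_on n (\<lambda>x. f' x v) S"
  shows "Ck_on (Suc n) f S"
proof -
  have "Ck_on n (\<lambda>x. frechet_derivative f (at x) v) S" for v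
  proof (rule Ck_on_cong[OF assms(1) _ assms(3)[of v]])
    show "frechet_derivative f (at x) v = f' x v" if "x \<in> S" for x
      using frechet_derivative_at[OF assms(2)[OF that]] by simp
  qed
  then show ?thesis using assms(2) unfolding differentiable_def Ck_on.simps by blast
qed

lemma Ck_on_const: "Ck_on n (\<lambda>x. c) S"
  by (induction n arbitrary: c) auto

lemma Ck_on_bounded_linear:
  assumes "open S" "bounded_linear f"
  shows "Ck_on n f S"
proof (cases n)
  case 0
  then show ?thesis using assms by (simp add: linear_continuous_on)
next
  case (Suc m)
  show ?thesis unfolding Suc
    by (rule Ck_on_SucI[OF assms(1)]) (auto intro: bounded_linear_imp_has_derivative assms Ck_on_const)
qed

lemma Ck_on_has_derivative:
  "Ck_on (Suc n) f S \<Longrightarrow> x \<in> S \<Longrightarrow> (f has_derivative frechet_derivative f (at x)) (at x)"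
  by (simp add: frechet_derivative_works)

lemma Ck_on_add:
  assumes "open S" "Ck_on n f S" "Ck_on n g S"
  shows "Ck_on n (\<lambda>x. f x + g x) S"
  using assms(2,3)
proof (induction n arbitrary: f g)
  case 0
  then show ?case by (auto intro: continuous_intros)
next
  case (Suc n)
  show ?case
    by (rule Ck_on_SucI[OF assms(1) has_derivative_add[OF Suc.prems[THEN Ck_on_has_derivative]]])
       (use Suc.prems in \<open>auto intro: Suc.IH\<close>)
qed

lemma Ck_on_sum:
  assumes "open S" "\<And>i. i \<in> I \<Longrightarrow> Ck_on n (f i) S"
  shows "Ck_on n (\<lambda>x. \<Sum>i\<in>I. f i x) S"
  using assms(2)
  by (induction I rule: infinite_finite_induct) (auto intro: Ck_on_const Ck_on_add[OF assms(1)])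

text \<open>The derivative is again a sum of values of \<open>bop\<close>, each with one factor
  differentiated, so the induction closes once \<open>f\<close> and \<open>g\<close> are both
  arbitrary.\<close>

lemma Ck_on_bilinear:
  assumes "open S" "bounded_bilinear bop" "Ck_on n f S" "Ck_on n g S"
  shows "Ck_on n (\<lambda>x. bop (f x) (g x)) S"
  using assms(3,4)
proof (induction n arbitrary: f g)
  case 0
  then show ?case by (auto intro: bounded_bilinear.continuous_on[OF assms(2)])
next
  case (Suc n)
  show ?case
    by (rule Ck_on_SucI[OF assms(1)
          bounded_bilinear.FDERIV[OF assms(2) Suc.prems[THEN Ck_on_has_derivative]]])
       (use Suc.prems[THEN Ck_on_SucD] Suc.prems in \<open>auto intro!: Ck_on_add[OF assms(1)] Suc.IH\<close>)
qed

lemma Ck_on_compose_linear: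
  assumes "open S" "bounded_linear h" "Ck_on n f S"
  shows "Ck_on n (\<lambda>x. h (f x)) S"
  using assms(3)
proof (induction n arbitrary: f)
  case 0
  then show ?case by (auto intro: bounded_linear.continuous_on[OF assms(2)])
next
  case (Suc n)
  show ?case
    by (rule Ck_on_SucI[OF assms(1) bounded_linear.has_derivative[OF assms(2) Suc.prems[THEN Ck_on_has_derivative]]])
       (use Suc.prems in \<open>auto intro: Suc.IH\<close>)
qed

text \<open>Real powers are closed under differentiation up to a factor: the exponent drops by one.
  Hence \<open>a\<close> is generalised in the induction, and an inverse square root is covered as a
  special case.\<close>

lemma Ck_on_powr:
  fixes f :: "'a::real_normed_vector \<Rightarrow> real"
  assumes "open S" "Ck_on n f S" "\<And>x. x \<in> S \<Longrightarrow> f x > 0"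
  shows "Ck_on n (\<lambda>x. f x powr a) S"
  using assms(2)
proof (induction n arbitrary: a)
  case 0
  then show ?case using assms(3) by (fastforce intro!: continuous_intros)
next
  case (Suc n)
  have "((\<lambda>x. f x powr a) has_derivative
      (\<lambda>v. (a * f x powr (a - 1)) * frechet_derivative f (at x) v)) (at x)" if "x \<in> S" for x
    \<comment> \<open>The rule for a variable exponent is used with a constant one;
      \<open>powr_diff\<close> turns its quotient by \<open>f x\<close> into the exponent
      \<open>a - 1\<close>.\<close>
    by (rule has_derivative_eq_rhs[OF has_derivative_powr[OF Ck_on_has_derivative[OF Suc.prems that] has_derivative_const]])
       (use assms(3)[OF that] in \<open>auto simp: powr_diff\<close>)
  then show ?case
    by (rule Ck_on_SucI[OF assms(1)])
       (use Suc Ck_on_SucD[OF Suc.prems] in \<open>auto intro!: Ck_on_bilinear[OF assms(1) bounded_bilinear_mult] Ck_on_const\<close>)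
qed

subsection \<open>Normalisation onto a product of spheres\<close>

lemma norm_poly_mapping: "norm x = (\<Sum>j\<in>Poly_Mapping.keys x. norm (Poly_Mapping.lookup x j))"
  by (simp add: norm_poly_mapping_def dist_poly_mapping_def)

lemma lookup_scaleR [simp]:
  "Poly_Mapping.lookup (c *\<^sub>R x) j = c *\<^sub>R Poly_Mapping.lookup (x :: 'a \<Rightarrow>\<^sub>0 'b::real_vector) j"
proof -
  have "finite {i. c *\<^sub>R Poly_Mapping.lookup x i \<noteq> 0}"
    by (rule finite_subset[OF _ finite_lookup[of x]]) auto
  then show ?thesis by (simp add: scaleR_poly_mapping_def)
qed

text \<open>The norm is the l1 norm of the coordinates, so it dominates each of them with constant
  1.\<close>

lemma bounded_linear_lookup:
  "bounded_linear (\<lambda>x :: 'a \<Rightarrow>\<^sub>0 'b::real_normed_vector. Poly_Mapping.lookup x j)"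
proof (rule bounded_linear_intro[where K = 1])
  fix x :: "'a \<Rightarrow>\<^sub>0 'b"
  show "norm (Poly_Mapping.lookup x j) \<le> norm x * 1"
    unfolding norm_poly_mapping
    by (cases "j \<in> Poly_Mapping.keys x")
       (auto intro!: member_le_sum sum_nonneg simp: in_keys_iff)
qed (auto simp: lookup_add)

lemma bounded_linear_single:
  "bounded_linear (Poly_Mapping.single j :: 'b::real_normed_vector \<Rightarrow> 'a \<Rightarrow>\<^sub>0 'b)"
proof (rule bounded_linear_intro[where K = 1])
  fix x :: 'b and c :: real
  show "Poly_Mapping.single j (c *\<^sub>R x) = c *\<^sub>R Poly_Mapping.single j x"
    by (rule poly_mapping_eqI) (simp add: lookup_single when_def)
  show "norm (Poly_Mapping.single j x) \<le> norm x * 1"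
    by (simp add: norm_poly_mapping)
qed (simp add: single_add)

section \<open>Block energies and the normalising map\<close>

definition energy :: "'j set \<Rightarrow> ('j \<Rightarrow>\<^sub>0 'b::real_inner) \<Rightarrow> real" where
  "energy K x = (\<Sum>j\<in>K. (norm (Poly_Mapping.lookup x j))\<^sup>2)"

text \<open>The fibres of \<kappa> are the blocks. Writing the map as a finite sum of
  \<open>Poly_Mapping.single\<close> reduces smoothness and differentiation to single
  coordinates.\<close>

definition normalise :: "'j set \<Rightarrow> ('j \<Rightarrow> 'k) \<Rightarrow> ('k \<Rightarrow> real) \<Rightarrow> ('j \<Rightarrow>\<^sub>0 'b::real_inner) \<Rightarrow> ('j \<Rightarrow>\<^sub>0 'b)" where
  "normalise J \<kappa> p x =
     (\<Sum>j\<in>J. Poly_Mapping.single j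
        ((sqrt (p (\<kappa> j)) / sqrt (energy {l \<in> J. \<kappa> l = \<kappa> j} x)) *\<^sub>R Poly_Mapping.lookup x j))"

text \<open>\<open>p k\<close> is the squared radius of block \<open>k\<close> in the Euclidean
  sense, not in the l1 norm of the ambient space.\<close>

definition sphere_product :: "'j set \<Rightarrow> ('j \<Rightarrow> 'k) \<Rightarrow> 'k set \<Rightarrow> ('k \<Rightarrow> real) \<Rightarrow> ('j \<Rightarrow>\<^sub>0 'b::real_inner) set" where
  "sphere_product J \<kappa> K p =
     {x. Poly_Mapping.keys x \<subseteq> J \<and> (\<forall>k\<in>K. energy {l \<in> J. \<kappa> l = k} x = p k)}"

text \<open>Up to the factor 2, the sums are the derivatives of the block energies at
  \<open>x\<close> in direction \<open>v\<close>.\<close>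

definition sphere_tangent :: "'j set \<Rightarrow> ('j \<Rightarrow> 'k) \<Rightarrow> 'k set \<Rightarrow> ('j \<Rightarrow>\<^sub>0 'b::real_inner) \<Rightarrow> ('j \<Rightarrow>\<^sub>0 'b) set" where
  "sphere_tangent J \<kappa> K x =
     {v. Poly_Mapping.keys v \<subseteq> J \<and>
         (\<forall>k\<in>K. (\<Sum>l\<in>{l \<in> J. \<kappa> l = k}. inner (Poly_Mapping.lookup x l) (Poly_Mapping.lookup v l)) = 0)}"

lemma energy_nonneg: "energy K x \<ge> 0"
  by (simp add: energy_def sum_nonneg)

lemma energy_add:
  "energy K (x + v) = energy K x
     + 2 * (\<Sum>l\<in>K. inner (Poly_Mapping.lookup x l) (Poly_Mapping.lookup v l)) + energy K v"
proof -
  have "(norm (Poly_Mapping.lookup (x + v) l))\<^sup>2 = (norm (Poly_Mapping.lookup x l))\<^sup>2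
      + 2 * inner (Poly_Mapping.lookup x l) (Poly_Mapping.lookup v l) + (norm (Poly_Mapping.lookup v l))\<^sup>2" for l
    by (simp add: lookup_add power2_norm_eq_inner inner_add inner_commute[of "Poly_Mapping.lookup v l" "Poly_Mapping.lookup x l"])
  then show ?thesis by (simp add: energy_def sum.distrib sum_distrib_left)
qed

text \<open>Pythagoras in each block: tangency removes the cross term of
  \<open>energy_add\<close>.\<close>

lemma energy_tangent:
  assumes "x \<in> sphere_product J \<kappa> K p" "v \<in> sphere_tangent J \<kappa> K x" "k \<in> K"
  shows "energy {l \<in> J. \<kappa> l = k} (x + v) = p k + energy {l \<in> J. \<kappa> l = k} v"
  using assms by (simp add: energy_add sphere_product_def sphere_tangent_def)

lemma lookup_normalise:
  assumes "finite J"
  shows "Poly_Mapping.lookup (normalise J \<kappa> p x) j =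
    (if j \<in> J then (sqrt (p (\<kappa> j)) / sqrt (energy {l \<in> J. \<kappa> l = \<kappa> j} x)) *\<^sub>R Poly_Mapping.lookup x j else 0)"
  using assms by (simp add: normalise_def lookup_sum lookup_single when_def sum.delta)

text \<open>The scale factor is constant on a block and the energy is homogeneous of degree two, so
  the old energy cancels.\<close>

lemma energy_normalise:
  assumes "finite J" "energy {l \<in> J. \<kappa> l = k} x > 0" "p k \<ge> 0"
  shows "energy {l \<in> J. \<kappa> l = k} (normalise J \<kappa> p x) = p k"
proof -
  let ?L = "{l \<in> J. \<kappa> l = k}"
  have "energy ?L (normalise J \<kappa> p x) =
      (\<Sum>l\<in>?L. p k / energy ?L x * (norm (Poly_Mapping.lookup x l))\<^sup>2)"
    unfolding energy_def[of _ "normalise J \<kappa> p x"] using assms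
    by (intro sum.cong) (auto simp: lookup_normalise power_mult_distrib power_divide)
  also have "\<dots> = p k / energy ?L x * energy ?L x"
    by (simp add: energy_def[of ?L x] sum_distrib_left)
  finally show ?thesis using assms by simp
qed

text \<open>A quadratic form has a critical point at the origin: both terms of the product rule
  contain the value 0.\<close>

lemma energy_has_derivative_zero: "(energy K has_derivative (\<lambda>_. 0)) (at 0 within T)"
proof -
  have lookup: "((\<lambda>v. Poly_Mapping.lookup v l) has_derivative (\<lambda>v. Poly_Mapping.lookup v l)) (at 0 within T)" for l
    by (rule bounded_linear_imp_has_derivative[OF bounded_linear_lookup])
  have "((\<lambda>v. inner (Poly_Mapping.lookup v l) (Poly_Mapping.lookup v l)) has_derivative (\<lambda>_. 0))
      (at 0 within T)" for l
    using has_derivative_inner[OF lookup[of l] lookup[of l]] by simp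
  then have "((\<lambda>v. \<Sum>l\<in>K. inner (Poly_Mapping.lookup v l) (Poly_Mapping.lookup v l))
      has_derivative (\<lambda>v. \<Sum>l\<in>K. 0)) (at 0 within T)"
    by (rule has_derivative_sum)
  then show ?thesis
    unfolding energy_def[abs_def] power2_norm_eq_inner by simp
qed

lemma Ck_on_energy:
  assumes "open S" "bounded_linear h"
  shows "Ck_on n (\<lambda>z. energy K (h z)) S"
  unfolding energy_def power2_norm_eq_inner
  by (intro Ck_on_sum Ck_on_bilinear[OF assms(1) bounded_bilinear_inner] Ck_on_bounded_linear
      bounded_linear_compose[OF bounded_linear_lookup] assms)

text \<open>All labels lie in \<open>K\<close>, so every coordinate belongs to a sphere of positive
  radius and no scale factor divides by zero on the tangent bundle.\<close>

theorem normalise_is_retraction: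
  fixes J :: "'j set" and \<kappa> :: "'j \<Rightarrow> 'k" and K :: "'k set"
  assumes J: "finite J" "\<kappa> ` J \<subseteq> K" and K: "finite K" and p: "\<And>k. k \<in> K \<Longrightarrow> p k > 0"
  shows "is_retraction (sphere_product J \<kappa> K p :: ('j \<Rightarrow>\<^sub>0 'b::real_inner) set)
     (sphere_tangent J \<kappa> K) (\<lambda>x v. normalise J \<kappa> p (x + v))"
proof -
  let ?M = "sphere_product J \<kappa> K p :: ('j \<Rightarrow>\<^sub>0 'b) set" and ?T = "sphere_tangent J \<kappa> K"
  let ?E = "\<lambda>k. energy {l \<in> J. \<kappa> l = k} :: ('j \<Rightarrow>\<^sub>0 'b) \<Rightarrow> real"
  have pos: "?E k (x + v) > 0" if "x \<in> ?M" "v \<in> ?T x" "k \<in> K" for x v k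
    using energy_tangent[OF that] p[OF that(3)] energy_nonneg[of _ v] by (simp add: add_pos_nonneg)
  have range: "normalise J \<kappa> p (x + v) \<in> ?M" if "x \<in> ?M" "v \<in> ?T x" for x v
    unfolding sphere_product_def
    using energy_normalise[where J = J and \<kappa> = \<kappa> and p = p and x = "x + v"] pos[OF that] p J(1)
    by (auto simp: in_keys_iff lookup_normalise less_imp_le split: if_splits)
  have smooth: "smooth_map_on (SIGMA x:?M. ?T x) (\<lambda>(x, v). normalise J \<kappa> p (x + v))"
    unfolding smooth_map_on_def
  proof
    fix z assume z: "z \<in> (SIGMA x:?M. ?T x)"
    define h where "h = (\<lambda>z :: ('j \<Rightarrow>\<^sub>0 'b) \<times> ('j \<Rightarrow>\<^sub>0 'b). fst z + snd z)"
    have h: "bounded_linear h"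
      unfolding h_def by (intro bounded_linear_add bounded_linear_fst bounded_linear_snd)
    \<comment> \<open>An open set containing the whole tangent bundle, so one neighbourhood and one
      extension serve all points \<open>z\<close>. Its definition supplies the positivity that
      \<open>Ck_on_powr\<close> asks for.\<close>
    define V where "V = (\<Inter>k\<in>K. {z. ?E k (h z) > 0})"
    have "continuous_on UNIV (\<lambda>z. ?E k (h z))" for k
      using Ck_on_energy[OF open_UNIV h, of 0] by simp
    then have V: "open V"
      unfolding V_def using K by (auto intro!: open_Collect_less)
    \<comment> \<open>The normalising map with its inverse square root written as the power -1/2, to
      fit \<open>Ck_on_powr\<close>.\<close>
    define g where "g = (\<lambda>z. \<Sum>j\<in>J. Poly_Mapping.single j
      ((sqrt (p (\<kappa> j)) * ?E (\<kappa> j) (h z) powr (-1/2)) *\<^sub>R Poly_Mapping.lookup (h z) j))"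
    have "Ck_on n g V" for n
      unfolding g_def
      by (intro Ck_on_sum Ck_on_compose_linear[OF _ bounded_linear_single]
          Ck_on_bilinear[OF _ bounded_bilinear_scaleR] Ck_on_bilinear[OF _ bounded_bilinear_mult]
          Ck_on_const Ck_on_powr Ck_on_energy Ck_on_bounded_linear
          bounded_linear_compose[OF bounded_linear_lookup] h V)
         (use J in \<open>auto simp: V_def\<close>)
    moreover have "g z = (case z of (x, v) \<Rightarrow> normalise J \<kappa> p (x + v))" if "z \<in> V" for z
    proof -
      have "?E (\<kappa> j) (h z) powr (-1/2) = inverse (sqrt (?E (\<kappa> j) (h z)))" if "j \<in> J" for j
      proof -
        have "?E (\<kappa> j) (h z) > 0" using \<open>z \<in> V\<close> that J by (auto simp: V_def)
        then show ?thesis by (simp add: powr_minus powr_half_sqrt)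
      qed
      then have "g z = normalise J \<kappa> p (h z)"
        unfolding g_def normalise_def divide_inverse[of "sqrt _"]
        by (intro sum.cong refl) (simp only:)
      then show ?thesis by (simp add: h_def split_def)
    qed
    moreover have "z \<in> V"
      using z pos by (auto simp: V_def h_def)
    ultimately show "\<exists>V g. open V \<and> z \<in> V \<and> (\<forall>n. Ck_on n g V) \<and>
        (\<forall>y\<in>V \<inter> (SIGMA x:?M. ?T x). g y = (case y of (x, v) \<Rightarrow> normalise J \<kappa> p (x + v)))"
      using V by blast
  qed
  have zero: "normalise J \<kappa> p (x + 0) = x" if "x \<in> ?M" for x
  proof (rule poly_mapping_eqI)
    fix j
    show "Poly_Mapping.lookup (normalise J \<kappa> p (x + 0)) j = Poly_Mapping.lookup x j"
      using that J p[of "\<kappa> j"] by (auto simp: lookup_normalise sphere_product_def in_keys_iff image_subset_iff)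
  qed
  have der: "((\<lambda>v. normalise J \<kappa> p (x + v)) has_derivative (\<lambda>v. v)) (at 0 within ?T x)"
    if x: "x \<in> ?M" for x
  proof -
    \<comment> \<open>The deviation of the scale factor from 1, with the energy of
      \<open>x + v\<close> rewritten by \<open>energy_tangent\<close>. In this form it depends on
      \<open>v\<close> only through a quadratic form, so its derivative at 0 vanishes in every
      direction, not just in tangent ones.\<close>
    define q where "q = (\<lambda>k v. sqrt (p k) / sqrt (p k + ?E k v) - 1)"
    have q: "(q k has_derivative (\<lambda>_. 0)) (at 0 within ?T x)" "q k 0 = 0" if "k \<in> K" for k
    proof -
      have "?E k 0 = 0" by (simp add: energy_def)
      then show "q k 0 = 0" using p[OF that] by (simp add: q_def)
      show "(q k has_derivative (\<lambda>_. 0)) (at 0 within ?T x)"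
        unfolding q_def using p[OF that] \<open>?E k 0 = 0\<close>
        by (auto intro!: derivative_eq_intros energy_has_derivative_zero)
    qed
    \<comment> \<open>On the tangent space the map is the translation by \<open>x\<close> plus terms of second order; the
      translation is kept apart so that the derivative is the identity on the whole ambient space.\<close>
    have eq: "normalise J \<kappa> p (x + v) =
        x + v + (\<Sum>j\<in>J. Poly_Mapping.single j (q (\<kappa> j) v *\<^sub>R Poly_Mapping.lookup (x + v) j))"
      if v: "v \<in> ?T x" for v
    proof (rule poly_mapping_eqI)
      fix j
      have "Poly_Mapping.lookup (x + v) j = 0" if "j \<notin> J"
      proof -
        have "j \<notin> Poly_Mapping.keys x" "j \<notin> Poly_Mapping.keys v"
          using x v that by (auto simp: sphere_product_def sphere_tangent_def)
        then show ?thesis by (simp add: in_keys_iff lookup_add)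
      qed
      moreover have "\<kappa> j \<in> K" if "j \<in> J" using that J by auto
      ultimately show "Poly_Mapping.lookup (normalise J \<kappa> p (x + v)) j = Poly_Mapping.lookup
          (x + v + (\<Sum>j\<in>J. Poly_Mapping.single j (q (\<kappa> j) v *\<^sub>R Poly_Mapping.lookup (x + v) j))) j"
        using energy_tangent[OF x v] J
        by (cases "j \<in> J")
           (simp_all add: lookup_normalise lookup_add[of "x + v"] lookup_sum lookup_single when_def
             q_def scaleR_diff_left)
    qed
    \<comment> \<open>Product rule: \<open>q\<close> vanishes at 0 together with its derivative, so
      both terms drop out.\<close>
    have "((\<lambda>v. q (\<kappa> j) v *\<^sub>R Poly_Mapping.lookup (x + v) j) has_derivative (\<lambda>_. 0))
        (at 0 within ?T x)" if "j \<in> J" for j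
    proof -
      have "\<kappa> j \<in> K" using that J by auto
      note [derivative_intros] = bounded_linear.has_derivative[OF bounded_linear_lookup] q(1)[OF this]
      show ?thesis
        by (auto intro!: derivative_eq_intros simp: q(2)[OF \<open>\<kappa> j \<in> K\<close>])
    qed
    then have "((\<lambda>v. x + v + (\<Sum>j\<in>J. Poly_Mapping.single j (q (\<kappa> j) v *\<^sub>R Poly_Mapping.lookup (x + v) j)))
        has_derivative (\<lambda>v. 0 + v + (\<Sum>j\<in>J. Poly_Mapping.single j 0))) (at 0 within ?T x)"
      by (intro has_derivative_add has_derivative_sum bounded_linear.has_derivative[OF bounded_linear_single]
          has_derivative_const has_derivative_ident)
    \<comment> \<open>The identity \<open>eq\<close> is available for tangent \<open>v\<close>, so
      the derivative is transferred within \<open>?T x\<close>; this requires 0 to be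
      tangent.\<close>
    then show ?thesis
      by (intro has_derivative_transform[OF _ eq]) (auto simp: sphere_tangent_def)
  qed
  show ?thesis
    unfolding is_retraction_def using range smooth zero der by blast
qed

subsection \<open>Traces in coordinates\<close>

text \<open>With equal block sizes, \<open>div\<close> finds the block and \<open>mod\<close> the
  place inside it. The induction peels off the first block.\<close>

lemma diag_block_mat_equal_size:
  assumes "\<forall>A\<in>set As. A \<in> carrier_mat m m"
  shows "diag_block_mat As \<in> carrier_mat (length As * m) (length As * m)"
    and "\<lbrakk>r < length As * m; c < length As * m\<rbrakk> \<Longrightarrow> diag_block_mat As $$ (r, c) =
      (if r div m = c div m then As ! (r div m) $$ (r mod m, c mod m) else 0)"
proof -
  have "diag_block_mat As \<in> carrier_mat (length As * m) (length As * m) \<and>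
    (\<forall>r c. r < length As * m \<longrightarrow> c < length As * m \<longrightarrow> diag_block_mat As $$ (r, c) =
      (if r div m = c div m then As ! (r div m) $$ (r mod m, c mod m) else 0))"
    using assms
  proof (induction As)
    case (Cons A As)
    let ?D = "diag_block_mat As"
    have IH: "dim_row ?D = length As * m" "dim_col ?D = length As * m"
      and entry: "\<And>r c. r < length As * m \<Longrightarrow> c < length As * m \<Longrightarrow> ?D $$ (r, c) =
        (if r div m = c div m then As ! (r div m) $$ (r mod m, c mod m) else 0)"
      using Cons by auto
    have A: "dim_row A = m" "dim_col A = m"
      using Cons.prems by auto
    \<comment> \<open>Passing to the tail lowers the block number by one and keeps the place in the
      block. The bounds on \<open>n\<close> exclude \<open>m = 0\<close>.\<close>
    have shift: "n div m = Suc ((n - m) div m)" "n mod m = (n - m) mod m"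
      if "m \<le> n" "n < m + length As * m" for n
    proof -
      have "m > 0" using that by (cases m) auto
      then show "n div m = Suc ((n - m) div m)" "n mod m = (n - m) mod m"
        using that by (auto simp: le_div_geq le_mod_geq)
    qed
    have "diag_block_mat (A # As) $$ (r, c) =
        (if r div m = c div m then (A # As) ! (r div m) $$ (r mod m, c mod m) else 0)"
      if "r < m + length As * m" "c < m + length As * m" for r c
      using that IH A
      by (cases "r < m"; cases "c < m") (auto simp: Let_def entry shift)
    then show ?case using IH A by (auto simp: Let_def)
  qed simp
  then show "diag_block_mat As \<in> carrier_mat (length As * m) (length As * m)"
    and "\<lbrakk>r < length As * m; c < length As * m\<rbrakk> \<Longrightarrow> diag_block_mat As $$ (r, c) =
      (if r div m = c div m then As ! (r div m) $$ (r mod m, c mod m) else 0)"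
    by blast+
qed

lemma dim_mat_adjoint [simp]:
  "dim_row (mat_adjoint A) = dim_col A" "dim_col (mat_adjoint A) = dim_row A"
  by (auto simp: mat_adjoint_def)

lemma mat_adjoint_index [simp]:
  "r < dim_col A \<Longrightarrow> c < dim_row A \<Longrightarrow> mat_adjoint A $$ (r, c) = conjugate (A $$ (c, r))"
  by (simp add: mat_adjoint_def mat_of_rows_index)

lemma mult_mat_index:
  "\<lbrakk>r < dim_row X; c < dim_col Y; dim_col X = dim_row Y\<rbrakk> \<Longrightarrow>
    (X * Y) $$ (r, c) = (\<Sum>l<dim_row Y. X $$ (r, l) * Y $$ (l, c))"
  by (simp add: scalar_prod_def lessThan_atLeast0)

text \<open>Blocks count from one and entries from zero; \<open>q > 0\<close> keeps the subtraction
  from truncating.\<close>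

lemma div_Suc_mod_eq_iff:
  fixes a m q s :: nat
  assumes "s < m" "q > 0"
  shows "a div m + 1 = q \<and> a mod m = s \<longleftrightarrow> a = (q - 1) * m + s"
  using assms by (auto simp: div_mult_mod_eq)

section \<open>The selection matrices W and Q\<close>

lemma Q_mat_carrier: "Q_mat B Mt k \<in> carrier_mat (B * Mt) (B * Mt)"
  and Q_mat_index: "\<lbrakk>a < B * Mt; b < B * Mt\<rbrakk> \<Longrightarrow>
    Q_mat B Mt k $$ (a, b) = (if a = b \<and> a div Mt + 1 = k then 1 else 0)"
proof -
  let ?blocks = "map (\<lambda>l. if l = k then 1\<^sub>m Mt else 0\<^sub>m Mt Mt :: complex mat) [1..<Suc B]"
  have blocks: "\<forall>A\<in>set ?blocks. A \<in> carrier_mat Mt Mt" by auto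
  have len: "length ?blocks = B" by simp
  show "Q_mat B Mt k \<in> carrier_mat (B * Mt) (B * Mt)"
    using diag_block_mat_equal_size(1)[OF blocks] unfolding Q_mat_def len .
  assume ab: "a < B * Mt" "b < B * Mt"
  then have "a div Mt < B" "Mt > 0" by (auto simp: less_mult_imp_div_less intro: gr0I)
  moreover have "a = b \<longleftrightarrow> a div Mt = b div Mt \<and> a mod Mt = b mod Mt"
    by (metis div_mult_mod_eq)
  ultimately show "Q_mat B Mt k $$ (a, b) = (if a = b \<and> a div Mt + 1 = k then 1 else 0)"
    using diag_block_mat_equal_size(2)[OF blocks, unfolded len, OF ab]
    by (auto simp del: upt_Suc simp: Q_mat_def)
qed

text \<open>Each column of \<open>W_mat\<close> contains a single 1, and distinctness of the
  stations puts these into different rows. Conjugating the diagonal matrix \<open>Q_mat\<close>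
  therefore leaves a diagonal matrix of zeros and ones.\<close>

lemma WQW_eq:
  assumes bs: "distinct (bs i)" "set (bs i) \<subseteq> {1..B}" and "Mt > 0"
  shows "mat_adjoint (W_mat B Mt bs i) * Q_mat B Mt k * W_mat B Mt bs i =
    mat (length (bs i) * Mt) (length (bs i) * Mt)
      (\<lambda>(r, c). if r = c \<and> bs i ! (r div Mt) = k then 1 else 0)" (is "?L = ?R")
proof -
  let ?W = "W_mat B Mt bs i" and ?Q = "Q_mat B Mt k" and ?n = "length (bs i) * Mt"
  note Q = Q_mat_index and Q_dim = carrier_matD[OF Q_mat_carrier]
  have W_dim: "dim_row ?W = B * Mt" "dim_col ?W = ?n"
    by (auto simp: W_mat_def)
  \<comment> \<open>The row of the 1 in column \<open>r\<close> of \<open>?W\<close>; the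
    \<open>- 1\<close> converts the station number to a block position counted from zero.\<close>
  define pos where "pos r = (bs i ! (r div Mt) - 1) * Mt + r mod Mt" for r
  have block: "bs i ! (r div Mt) \<in> {1..B}" if "r < ?n" for r
    using that bs(2) by (meson less_mult_imp_div_less nth_mem subsetD)
  have W: "?W $$ (a, r) = (if a = pos r then 1 else 0)" if "a < B * Mt" "r < ?n" for a r
    using that block[OF that(2)] div_Suc_mod_eq_iff[of "r mod Mt" Mt "bs i ! (r div Mt)" a] \<open>Mt > 0\<close>
    by (simp add: W_mat_def pos_def)
  have pos_less: "pos r < B * Mt" if "r < ?n" for r
  proof -
    have "pos r < (bs i ! (r div Mt) - 1) * Mt + Mt"
      using \<open>Mt > 0\<close> by (simp add: pos_def)
    also have "\<dots> = bs i ! (r div Mt) * Mt"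
      using block[OF that] by (cases "bs i ! (r div Mt)") auto
    also have "\<dots> \<le> B * Mt" using block[OF that] by simp
    finally show ?thesis .
  qed
  have pos_div: "pos r div Mt + 1 = bs i ! (r div Mt)" "pos r mod Mt = r mod Mt" if "r < ?n" for r
    using div_Suc_mod_eq_iff[of "r mod Mt" Mt "bs i ! (r div Mt)" "pos r"] block[OF that] \<open>Mt > 0\<close>
    by (auto simp: pos_def)
  have pos_eq: "pos r = pos c \<longleftrightarrow> r = c" if "r < ?n" "c < ?n" for r c
  proof
    assume "pos r = pos c"
    then have "bs i ! (r div Mt) = bs i ! (c div Mt)" "r mod Mt = c mod Mt"
      using pos_div that by metis+
    then show "r = c"
      using bs(1) that by (metis div_mult_mod_eq less_mult_imp_div_less nth_eq_iff_index_eq)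
  qed simp
  have WQ: "(mat_adjoint ?W * ?Q) $$ (r, b) =
      (if b = pos r \<and> bs i ! (r div Mt) = k then 1 else 0)" if "r < ?n" "b < B * Mt" for r b
  proof -
    have "(mat_adjoint ?W * ?Q) $$ (r, b) = (\<Sum>a<B * Mt. mat_adjoint ?W $$ (r, a) * ?Q $$ (a, b))"
      using that by (subst mult_mat_index) (auto simp: W_dim Q_dim)
    also have "\<dots> = (\<Sum>a<B * Mt. if a = pos r then if a = b \<and> a div Mt + 1 = k then 1 else 0 else 0)"
      using that by (intro sum.cong refl) (simp add: W_dim W Q)
    finally show ?thesis using that pos_less[OF that(1)] pos_div[OF that(1)] by auto
  qed
  show ?thesis
  proof (rule eq_matI)
    fix r c assume "r < dim_row ?R" "c < dim_col ?R"
    then have rc: "r < ?n" "c < ?n" by auto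
    have "?L $$ (r, c) = (\<Sum>b<B * Mt. (mat_adjoint ?W * ?Q) $$ (r, b) * ?W $$ (b, c))"
      using rc by (subst mult_mat_index) (auto simp: W_dim Q_dim)
    also have "\<dots> =
        (\<Sum>b<B * Mt. if b = pos c then if b = pos r \<and> bs i ! (r div Mt) = k then 1 else 0 else 0)"
      using rc by (intro sum.cong refl) (simp add: W WQ)
    finally show "?L $$ (r, c) = ?R $$ (r, c)"
      using rc pos_less[OF rc(2)] pos_eq[OF rc] by auto
  qed (auto simp: W_dim)
qed

text \<open>By \<open>WQW_eq\<close> the middle factor only selects the rows of station
  \<open>k\<close>, which leaves a Hermitian inner product of the selected entries.\<close>

lemma power_term_eq:
  assumes bs: "distinct (bs i)" "set (bs i) \<subseteq> {1..B}" and "Mt > 0"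
  shows "power_term B Mt d bs k i X Y \<in> carrier_mat (d i) (d i)"
    and "tr (power_term B Mt d bs k i X Y) =
      (\<Sum>(r, c)\<in>{(r, c). r < length (bs i) * Mt \<and> c < d i \<and> bs i ! (r div Mt) = k}.
        cnj (Poly_Mapping.lookup X (i, r, c)) * Poly_Mapping.lookup Y (i, r, c))"
proof -
  let ?n = "length (bs i) * Mt"
  let ?W = "W_mat B Mt bs i" and ?Q = "Q_mat B Mt k"
  let ?X = "component Mt d bs X i" and ?Y = "component Mt d bs Y i"
  let ?S = "mat ?n ?n (\<lambda>(r, c). if r = c \<and> bs i ! (r div Mt) = k then 1 else 0) :: complex mat"
  have W: "?W \<in> carrier_mat (B * Mt) ?n" and X: "?X \<in> carrier_mat ?n (d i)" and Y: "?Y \<in> carrier_mat ?n (d i)"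
    by (auto simp: W_mat_def component_def)
  have WH: "mat_adjoint ?W \<in> carrier_mat ?n (B * Mt)" and XH: "mat_adjoint ?X \<in> carrier_mat (d i) ?n"
    using W X by (auto intro!: carrier_matI)
  note Q = Q_mat_carrier[of B Mt k]
  \<comment> \<open>Reassociation isolates the factor to which \<open>WQW_eq\<close>
    applies.\<close>
  have "power_term B Mt d bs k i X Y = mat_adjoint ?X * (mat_adjoint ?W * ?Q * ?W) * ?Y"
    unfolding power_term_def using Q W X Y WH XH
    by (smt (verit) assoc_mult_mat mult_carrier_mat)
  also have "\<dots> = mat_adjoint ?X * (?S * ?Y)"
    unfolding WQW_eq[of bs i B Mt, OF assms] by (rule assoc_mult_mat[OF XH _ Y]) auto
  finally have eq: "power_term B Mt d bs k i X Y = mat_adjoint ?X * (?S * ?Y)" .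
  show "power_term B Mt d bs k i X Y \<in> carrier_mat (d i) (d i)"
    unfolding eq using X Y by (auto intro!: carrier_matI)
  have SY: "(?S * ?Y) $$ (r, c) = (if bs i ! (r div Mt) = k then ?Y $$ (r, c) else 0)"
    if "r < ?n" "c < d i" for r c
  proof -
    have "(?S * ?Y) $$ (r, c) = (\<Sum>l<?n. ?S $$ (r, l) * ?Y $$ (l, c))"
      using that Y by (subst mult_mat_index) auto
    also have "\<dots> = (\<Sum>l<?n. if l = r then if bs i ! (r div Mt) = k then ?Y $$ (l, c) else 0 else 0)"
      using that by (intro sum.cong refl) auto
    finally show ?thesis using that by simp
  qed
  have "tr (power_term B Mt d bs k i X Y) =
      (\<Sum>c<d i. \<Sum>r<?n. cnj (?X $$ (r, c)) * (if bs i ! (r div Mt) = k then ?Y $$ (r, c) else 0))"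
    unfolding eq tr_def using X Y SY
    by (auto intro!: sum.cong simp del: index_mult_mat(1) simp: mult_mat_index)
  also have "\<dots> = (\<Sum>c<d i. \<Sum>r<?n. if bs i ! (r div Mt) = k then
      cnj (Poly_Mapping.lookup X (i, r, c)) * Poly_Mapping.lookup Y (i, r, c) else 0)"
    by (intro sum.cong refl) (auto simp: component_def)
  also have "\<dots> = (\<Sum>(r, c)\<in>{..<?n} \<times> {..<d i}. if bs i ! (r div Mt) = k then
      cnj (Poly_Mapping.lookup X (i, r, c)) * Poly_Mapping.lookup Y (i, r, c) else 0)"
    by (subst sum.swap) (simp add: sum.cartesian_product)
  also have "\<dots> = (\<Sum>(r, c)\<in>{(r, c). r < ?n \<and> c < d i \<and> bs i ! (r div Mt) = k}.
        cnj (Poly_Mapping.lookup X (i, r, c)) * Poly_Mapping.lookup Y (i, r, c))"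
    by (rule sum.mono_neutral_cong_right) (auto split: if_splits)
  finally show "tr (power_term B Mt d bs k i X Y) = \<dots>" .
qed

section \<open>Identification with a product of spheres\<close>

definition tuple_keys :: "nat \<Rightarrow> nat \<Rightarrow> (nat \<Rightarrow> nat) \<Rightarrow> (nat \<Rightarrow> nat list) \<Rightarrow> (nat \<times> nat \<times> nat) set" where
  "tuple_keys U Mt d bs = {(i, r, c). i \<in> {1..U} \<and> r < length (bs i) * Mt \<and> c < d i}"

text \<open>The labelling \<kappa> for the abstract theorem: the station that serves the row of an
  entry.\<close>

definition station :: "nat \<Rightarrow> (nat \<Rightarrow> nat list) \<Rightarrow> nat \<times> nat \<times> nat \<Rightarrow> nat" where
  "station Mt bs = (\<lambda>(i, r, c). bs i ! (r div Mt))"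

abbreviation station_keys :: "nat \<Rightarrow> nat \<Rightarrow> (nat \<Rightarrow> nat) \<Rightarrow> (nat \<Rightarrow> nat list) \<Rightarrow> nat \<Rightarrow> (nat \<times> nat \<times> nat) set" where
  "station_keys U Mt d bs k \<equiv> {l \<in> tuple_keys U Mt d bs. station Mt bs l = k}"

lemma finite_tuple_keys: "finite (tuple_keys U Mt d bs)"
proof (rule finite_subset)
  show "tuple_keys U Mt d bs \<subseteq> (SIGMA i:{1..U}. {..<length (bs i) * Mt} \<times> {..<d i})"
    by (auto simp: tuple_keys_def)
qed auto

lemma station_in_set:
  "r < length (bs i) * Mt \<Longrightarrow> station Mt bs (i, r, c) \<in> set (bs i)"
  by (simp add: station_def less_mult_imp_div_less)

lemma Gamma_mat_carrier:
    "Gamma_mat B U Mt d bs p P \<xi> i \<in> carrier_mat (length (bs i) * Mt) (length (bs i) * Mt)"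
  and Gamma_mat_index: "\<lbrakk>r < length (bs i) * Mt; l < length (bs i) * Mt\<rbrakk> \<Longrightarrow>
    Gamma_mat B U Mt d bs p P \<xi> i $$ (r, l) =
      (if l = r then complex_of_real (gamma B U Mt d bs p P \<xi> (bs i ! (r div Mt))) else 0)"
proof -
  let ?blocks = "map (\<lambda>k. complex_of_real (gamma B U Mt d bs p P \<xi> k) \<cdot>\<^sub>m 1\<^sub>m Mt) (bs i)"
  have blocks: "\<forall>A\<in>set ?blocks. A \<in> carrier_mat Mt Mt" by auto
  have len: "length ?blocks = length (bs i)" by simp
  show "Gamma_mat B U Mt d bs p P \<xi> i \<in> carrier_mat (length (bs i) * Mt) (length (bs i) * Mt)"
    using diag_block_mat_equal_size(1)[OF blocks] unfolding Gamma_mat_def len .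
  assume rl: "r < length (bs i) * Mt" "l < length (bs i) * Mt"
  then have "r div Mt < length (bs i)" "Mt > 0" by (auto simp: less_mult_imp_div_less intro: gr0I)
  moreover have "l = r \<longleftrightarrow> r div Mt = l div Mt \<and> r mod Mt = l mod Mt"
    by (metis div_mult_mod_eq)
  ultimately show "Gamma_mat B U Mt d bs p P \<xi> i $$ (r, l) =
      (if l = r then complex_of_real (gamma B U Mt d bs p P \<xi> (bs i ! (r div Mt))) else 0)"
    using diag_block_mat_equal_size(2)[OF blocks, unfolded len, OF rl]
    by (auto simp: Gamma_mat_def)
qed

lemma tr_add: "A \<in> carrier_mat n n \<Longrightarrow> C \<in> carrier_mat n n \<Longrightarrow> tr (A + C) = tr A + tr C"
  by (auto simp: tr_def sum.distrib)

lemma cnj_mult_self: "cnj z * z = complex_of_real ((norm z)\<^sup>2)"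
  by (simp only: complex_norm_square mult.commute)

text \<open>The symmetrised Hermitian product is real. This turns the complex tangency condition
  into real orthogonality.\<close>

lemma cnj_mult_add_commuted: "cnj v * x + cnj x * v = complex_of_real (2 * inner x v)"
  by (simp add: complex_eq_iff inner_complex_def)

context
  fixes B U Mt :: nat and d :: "nat \<Rightarrow> nat" and bs :: "nat \<Rightarrow> nat list"
  assumes Mt: "Mt > 0"
    and bs: "\<And>i. i \<in> {1..U} \<Longrightarrow> distinct (bs i) \<and> set (bs i) \<subseteq> {1..B}"
begin

text \<open>The double sum merges into one: an entry labelled \<open>k\<close> already shows that
  \<open>k\<close> occurs in \<open>bs i\<close>, so its user is counted in
  \<open>users U bs k\<close>.\<close>

lemma sum_tr_power_term:
  "(\<Sum>i\<in>users U bs k. tr (power_term B Mt d bs k i X Y)) =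
    (\<Sum>l\<in>station_keys U Mt d bs k. cnj (Poly_Mapping.lookup X l) * Poly_Mapping.lookup Y l)"
proof -
  let ?A = "\<lambda>i. {(r, c). r < length (bs i) * Mt \<and> c < d i \<and> bs i ! (r div Mt) = k}"
  let ?f = "\<lambda>l. cnj (Poly_Mapping.lookup X l) * Poly_Mapping.lookup Y l"
  have fin: "finite (?A i)" for i
    by (rule finite_subset[of _ "{..<length (bs i) * Mt} \<times> {..<d i}"]) auto
  have "(\<Sum>i\<in>users U bs k. tr (power_term B Mt d bs k i X Y)) =
      (\<Sum>i\<in>users U bs k. \<Sum>rc\<in>?A i. ?f (i, rc))"
  proof (rule sum.cong[OF refl])
    fix i assume "i \<in> users U bs k"
    then have "distinct (bs i)" "set (bs i) \<subseteq> {1..B}" using bs by (auto simp: users_def)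
    then show "tr (power_term B Mt d bs k i X Y) = (\<Sum>rc\<in>?A i. ?f (i, rc))"
      using Mt by (simp add: power_term_eq(2) case_prod_unfold)
  qed
  also have "\<dots> = (\<Sum>l\<in>(SIGMA i:users U bs k. ?A i). ?f l)"
    by (subst sum.Sigma[OF _ ballI[OF fin]]) (simp_all add: users_def)
  also have "(SIGMA i:users U bs k. ?A i) = station_keys U Mt d bs k"
    using station_in_set[of _ bs _ Mt] by (fastforce simp: tuple_keys_def station_def users_def)
  finally show ?thesis .
qed

lemma sum_tr_power_term_self:
  "(\<Sum>i\<in>users U bs k. tr (power_term B Mt d bs k i X X)) =
    complex_of_real (energy (station_keys U Mt d bs k) X)"
  by (simp add: sum_tr_power_term cnj_mult_self energy_def)

lemma prod_space_eq: "prod_space U Mt d bs = {P. Poly_Mapping.keys P \<subseteq> tuple_keys U Mt d bs}"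
  by (simp only: prod_space_def tuple_keys_def)

lemma power_manifold_eq:
  "power_manifold B U Mt d bs p = sphere_product (tuple_keys U Mt d bs) (station Mt bs) {1..B} p"
  by (simp add: power_manifold_def sphere_product_def prod_space_eq sum_tr_power_term_self)

lemma tangent_space_eq:
  "tangent_space B U Mt d bs = sphere_tangent (tuple_keys U Mt d bs) (station Mt bs) {1..B}"
proof -
  have eq: "(\<Sum>i\<in>users U bs k. tr (power_term B Mt d bs k i \<xi> P + power_term B Mt d bs k i P \<xi>)) =
      complex_of_real (2 * (\<Sum>l\<in>station_keys U Mt d bs k.
        inner (Poly_Mapping.lookup P l) (Poly_Mapping.lookup \<xi> l)))" for k P \<xi>
  proof -
    have "(\<Sum>i\<in>users U bs k. tr (power_term B Mt d bs k i \<xi> P + power_term B Mt d bs k i P \<xi>)) =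
        (\<Sum>i\<in>users U bs k. tr (power_term B Mt d bs k i \<xi> P) + tr (power_term B Mt d bs k i P \<xi>))"
    proof (rule sum.cong[OF refl])
      fix i assume "i \<in> users U bs k"
      then have "distinct (bs i)" "set (bs i) \<subseteq> {1..B}" using bs by (auto simp: users_def)
      note carrier = power_term_eq(1)[of bs i B Mt, OF this Mt]
      show "tr (power_term B Mt d bs k i \<xi> P + power_term B Mt d bs k i P \<xi>) =
          tr (power_term B Mt d bs k i \<xi> P) + tr (power_term B Mt d bs k i P \<xi>)"
        by (rule tr_add[OF carrier carrier])
    qed
    also have "\<dots> = (\<Sum>l\<in>station_keys U Mt d bs k.
        complex_of_real (2 * inner (Poly_Mapping.lookup P l) (Poly_Mapping.lookup \<xi> l)))"
      by (simp only: sum.distrib sum_tr_power_term flip: cnj_mult_add_commuted)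
    finally show ?thesis by (simp add: sum_distrib_left)
  qed
  show ?thesis
    unfolding fun_eq_iff tangent_space_def sphere_tangent_def prod_space_eq eq of_real_eq_0_iff
    by simp
qed

text \<open>\<open>Gamma_mat\<close> is diagonal and multiplies each row by the factor of its
  station. The equation holds for arbitrary \<open>P\<close> and \<xi>: both sides vanish off
  \<open>tuple_keys\<close> and contain the same quotients, even when a denominator is zero.\<close>

lemma power_retraction_eq:
  "power_retraction B U Mt d bs p P \<xi> =
    normalise (tuple_keys U Mt d bs) (station Mt bs) p (P + \<xi>)"
proof (rule poly_mapping_eqI)
  fix l :: "nat \<times> nat \<times> nat"
  obtain i r c where l: "l = (i, r, c)" by (cases l)
  let ?G = "Gamma_mat B U Mt d bs p P \<xi> i"
  let ?Z = "component Mt d bs P i + component Mt d bs \<xi> i"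
  have dims: "dim_row ?G = length (bs i) * Mt" "dim_col ?G = length (bs i) * Mt"
    "dim_row ?Z = length (bs i) * Mt" "dim_col ?Z = d i"
    using Gamma_mat_carrier[of B U Mt d bs p P \<xi> i] by (auto simp: component_def)
  have entry: "(?G * ?Z) $$ (r, c) = gamma B U Mt d bs p P \<xi> (bs i ! (r div Mt)) *
      (Poly_Mapping.lookup P (i, r, c) + Poly_Mapping.lookup \<xi> (i, r, c))"
    if rc: "r < length (bs i) * Mt" "c < d i"
  proof -
    have "(?G * ?Z) $$ (r, c) = (\<Sum>s<length (bs i) * Mt. ?G $$ (r, s) * ?Z $$ (s, c))"
      using rc by (subst mult_mat_index) (simp_all only: dims)
    also have "\<dots> = (\<Sum>s<length (bs i) * Mt. if s = r then
        gamma B U Mt d bs p P \<xi> (bs i ! (r div Mt)) * ?Z $$ (s, c) else 0)"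
      using rc by (intro sum.cong refl) (simp add: Gamma_mat_index)
    also have "\<dots> = gamma B U Mt d bs p P \<xi> (bs i ! (r div Mt)) * ?Z $$ (r, c)"
      using rc by simp
    finally show ?thesis using rc by (simp add: component_def)
  qed
  have gamma: "gamma B U Mt d bs p P \<xi> k =
      sqrt (p k) / sqrt (energy (station_keys U Mt d bs k) (P + \<xi>))" for k
    by (simp add: gamma_def sum_tr_power_term_self)
  show "Poly_Mapping.lookup (power_retraction B U Mt d bs p P \<xi>) l =
      Poly_Mapping.lookup (normalise (tuple_keys U Mt d bs) (station Mt bs) p (P + \<xi>)) l"
  proof (cases "l \<in> tuple_keys U Mt d bs")
    case True
    then have irc: "i \<in> {1..U}" "r < length (bs i) * Mt" "c < d i"
      by (auto simp: l tuple_keys_def)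
    have "Poly_Mapping.lookup (power_retraction B U Mt d bs p P \<xi>) l = (?G * ?Z) $$ (r, c)"
      unfolding l power_retraction_def lookup_tuple_of index_mult_mat(2,3) dims using irc by simp
    also have "\<dots> = gamma B U Mt d bs p P \<xi> (station Mt bs l) *\<^sub>R Poly_Mapping.lookup (P + \<xi>) l"
      unfolding entry[OF irc(2,3)] by (simp add: l station_def lookup_add scaleR_conv_of_real)
    finally show ?thesis
      unfolding lookup_normalise[OF finite_tuple_keys] gamma using True by simp
  next
    case False
    then show ?thesis
      unfolding l power_retraction_def lookup_tuple_of index_mult_mat(2,3) dims
        lookup_normalise[OF finite_tuple_keys]
      by (auto simp: tuple_keys_def)
  qed
qed

end

theorem theorem3:
  fixes B U Mt :: nat and d :: "nat \<Rightarrow> nat" and bs :: "nat \<Rightarrow> nat list" and p :: "nat \<Rightarrow> real"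
  assumes "B > 0" and "U > 0" and "Mt > 0"
    and "\<And>i. i \<in> {1..U} \<Longrightarrow> d i > 0"
    and "\<And>i. i \<in> {1..U} \<Longrightarrow> bs i \<noteq> [] \<and> distinct (bs i) \<and> set (bs i) \<subseteq> {1..B}"
    and "\<And>k. k \<in> {1..B} \<Longrightarrow> p k > 0"
  shows "is_retraction (power_manifold B U Mt d bs p) (tangent_space B U Mt d bs)
           (power_retraction B U Mt d bs p)"
proof -
  have bs: "\<And>i. i \<in> {1..U} \<Longrightarrow> distinct (bs i) \<and> set (bs i) \<subseteq> {1..B}"
    using assms(5) by blast
  have "station Mt bs ` tuple_keys U Mt d bs \<subseteq> {1..B}"
    using bs station_in_set[of _ bs _ Mt] by (fastforce simp: tuple_keys_def)
  then have "is_retraction (sphere_product (tuple_keys U Mt d bs) (station Mt bs) {1..B} p :: tuple set)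
      (sphere_tangent (tuple_keys U Mt d bs) (station Mt bs) {1..B})
      (\<lambda>P \<xi>. normalise (tuple_keys U Mt d bs) (station Mt bs) p (P + \<xi>))"
    using assms(6) by (intro normalise_is_retraction finite_tuple_keys) auto
  \<comment> \<open>An equality of functions, not only on the tangent bundle, so the map can be
    replaced inside \<open>is_retraction\<close> by plain rewriting.\<close>
  moreover have "power_retraction B U Mt d bs p =
      (\<lambda>P \<xi>. normalise (tuple_keys U Mt d bs) (station Mt bs) p (P + \<xi>))"
    using power_retraction_eq[where bs = bs and U = U, OF \<open>Mt > 0\<close> bs] by blast
  ultimately show ?thesis
    by (simp only: power_manifold_eq[where bs = bs and U = U, OF \<open>Mt > 0\<close> bs]
        tangent_space_eq[where bs = bs and U = U, OF \<open>Mt > 0\<close> bs])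
qed

end
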